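(* Let $E$ be a finite set. A function from $B_E$ to $B_E$ is the closure operator of a polymatroid on $E$ if and only if it is the closure operator $\operatorname{cl}_\theta$ of a strong surjection $\theta:\mathscr{B}_E\rightarrow(L,G)$ onto some generator enriched lattice $(L,G)$.
   Context: $B_E$ is the set of subsets of $E$ ordered by inclusion. A polymatroid on $E$ is a function $r:B_E\to\mathbb{R}_{\ge0}$ with $r(\emptyset)=0$, $r(X)\le r(Y)$ whenever $X\subseteq Y$, and $r(X\cap Y)+r(X\cup Y)\le r(X)+r(Y)$; its closure operator is $X\mapsto\{e\in E: r(X)=r(X\cup\{e\})\}$. A generator enriched lattice is a pair $(L,G)$ where $L$ is a finite lattice and $G\subseteq L\setminus\{\widehat{0}\}$ generates $L$ under joins. $\mathscr{B}_E=(B_E,\{\{e\}:e\in E\})$. A strong map $f:(L,G)\to(K,H)$ is a join-preserving map $f:L\to K$ with $f(G)\subseteq H\cup\{\widehat0_K\}$; it is a strong surjection if moreover $f(G\cup\{\widehat0_L\})=H\cup\{\widehat0_K\}$. For a strong surjection $\theta:\mathscr B_E\to(L,G)$ define $\phi:L\to B_E$ by $\phi(\ell)=\bigcup_{X\in\theta^{-1}(\ell)}X$; the closure operator of $\theta$ is $\operatorname{cl}_\theta=\phi\circ\theta:B_E\to B_E$. *)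

theory Defs
  imports Complex_Main "HOL-Algebra.Complete_Lattice"
begin

definition polymatroid :: "'a set \<Rightarrow> ('a set \<Rightarrow> real) \<Rightarrow> bool" where
  "polymatroid E r \<longleftrightarrow>
     (\<forall>X \<in> Pow E. 0 \<le> r X) \<and>
     r {} = 0 \<and>
     (\<forall>X \<in> Pow E. \<forall>Y \<in> Pow E. X \<subseteq> Y \<longrightarrow> r X \<le> r Y) \<and>
     (\<forall>X \<in> Pow E. \<forall>Y \<in> Pow E. r (X \<inter> Y) + r (X \<union> Y) \<le> r X + r Y)"

definition polymatroid_closure :: "'a set \<Rightarrow> ('a set \<Rightarrow> real) \<Rightarrow> 'a set \<Rightarrow> 'a set" where
  "polymatroid_closure E r X = {e \<in> E. r X = r (X \<union> {e})}"

text \<open>A lattice of HOL-Algebra may have an empty carrier, so nonemptiness is required explicitly.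
  The bottom element, which is not in \<open>G\<close>, is the join of the empty subset of \<open>G\<close>.\<close>

definition generator_enriched_lattice :: "'l gorder \<Rightarrow> 'l set \<Rightarrow> bool" where
  "generator_enriched_lattice L G \<longleftrightarrow>
     Lattice.lattice L \<and> finite (carrier L) \<and> carrier L \<noteq> {} \<and>
     G \<subseteq> carrier L - {\<bottom>\<^bsub>L\<^esub>} \<and>
     (\<forall>x \<in> carrier L. \<exists>S \<subseteq> G. x = \<Squnion>\<^bsub>L\<^esub> S)"

definition boolean_lattice :: "'a set \<Rightarrow> 'a set gorder" where
  "boolean_lattice E = \<lparr>carrier = Pow E, eq = (=), le = (\<subseteq>)\<rparr>"

definition boolean_generators :: "'a set \<Rightarrow> 'a set set" where
  "boolean_generators E = {{e} | e. e \<in> E}"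

text \<open>Join preservation is preservation of binary joins; for strong surjections this already
  implies that the bottom element is preserved.\<close>

definition strong_map ::
  "'l gorder \<Rightarrow> 'l set \<Rightarrow> 'k gorder \<Rightarrow> 'k set \<Rightarrow> ('l \<Rightarrow> 'k) \<Rightarrow> bool" where
  "strong_map L G K H f \<longleftrightarrow>
     generator_enriched_lattice L G \<and> generator_enriched_lattice K H \<and>
     f \<in> carrier L \<rightarrow> carrier K \<and> join_pres L K f \<and>
     f ` G \<subseteq> H \<union> {\<bottom>\<^bsub>K\<^esub>}"

definition strong_surjection ::
  "'l gorder \<Rightarrow> 'l set \<Rightarrow> 'k gorder \<Rightarrow> 'k set \<Rightarrow> ('l \<Rightarrow> 'k) \<Rightarrow> bool" where
  "strong_surjection L G K H f \<longleftrightarrow>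
     strong_map L G K H f \<and> f ` (G \<union> {\<bottom>\<^bsub>L\<^esub>}) = H \<union> {\<bottom>\<^bsub>K\<^esub>}"

definition fiber_union :: "'a set \<Rightarrow> ('a set \<Rightarrow> 'l) \<Rightarrow> 'l \<Rightarrow> 'a set" where
  "fiber_union E \<theta> l = \<Union> {X \<in> Pow E. \<theta> X = l}"

definition surjection_closure :: "'a set \<Rightarrow> ('a set \<Rightarrow> 'l) \<Rightarrow> 'a set \<Rightarrow> 'a set" where
  "surjection_closure E \<theta> = fiber_union E \<theta> \<circ> \<theta>"

end

theory Submission
  imports Defs
begin

text \<open>Both kinds of closure operators are exactly the extensive, monotone, idempotent operators on
  \<open>Pow E\<close>. Such an operator is realised by the strong surjection \<open>X \<mapsto> c X\<close> onto its lattice of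
  closed sets, and by the polymatroid \<open>r X =\<close> number of closed sets not containing \<open>X\<close>, a sum of
  rank functions of matroids of rank at most one.\<close>

section \<open>Closure operators and the lattice of their closed sets\<close>

locale closure_operator =
  fixes E :: "'a set" and c :: "'a set \<Rightarrow> 'a set"
  assumes closed: "X \<subseteq> E \<Longrightarrow> c X \<subseteq> E"
    and extensive: "X \<subseteq> E \<Longrightarrow> X \<subseteq> c X"
    and monotone: "X \<subseteq> Y \<Longrightarrow> Y \<subseteq> E \<Longrightarrow> c X \<subseteq> c Y"
    and idempotent: "X \<subseteq> E \<Longrightarrow> c (c X) = c X"
begin

definition flats :: "'a set gorder" where
  "flats = \<lparr>carrier = c ` Pow E, eq = (=), le = (\<subseteq>)\<rparr>"

text \<open>A singleton from \<open>c {}\<close> has closure \<open>c {}\<close>, the bottom flat,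
  which is removed since generators must be nonzero.\<close>

definition flat_generators :: "'a set set" where
  "flat_generators = {c {e} | e. e \<in> E} - {c {}}"

lemma carrier_flats [simp]: "carrier flats = c ` Pow E"
  and le_flats [simp]: "le flats = (\<subseteq>)"
  and eq_flats [simp]: "eq flats = (=)"
  by (simp_all add: flats_def)

lemma flat_subset: "F \<in> c ` Pow E \<Longrightarrow> F \<subseteq> E"
  using closed by auto

text \<open>Idempotence makes \<open>F\<close> its own closure, so monotonicity applies.\<close>

lemma closure_subset_flat: "X \<subseteq> F \<Longrightarrow> F \<in> c ` Pow E \<Longrightarrow> c X \<subseteq> F"
  using monotone[of X F] flat_subset[of F] idempotent by auto

lemma least_upper_flats:
  assumes "S \<subseteq> c ` Pow E"
  shows "least flats (c (\<Union>S)) (Upper flats S)"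
proof -
  have sub: "\<Union>S \<subseteq> E"
    using assms closed by blast
  have "F \<subseteq> c (\<Union>S)" if "F \<in> S" for F
    using extensive[OF sub] that by blast
  moreover have "c (\<Union>S) \<subseteq> F" if "F \<in> Upper flats S" for F
    using that assms by (intro closure_subset_flat) (auto simp: Upper_def)
  ultimately show ?thesis
    using sub by (auto simp: least_def Upper_def)
qed

lemma greatest_lower_flats:
  assumes "F1 \<in> c ` Pow E" "F2 \<in> c ` Pow E"
  shows "greatest flats (F1 \<inter> F2) (Lower flats {F1, F2})"
proof -
  have sub: "F1 \<inter> F2 \<subseteq> E"
    using flat_subset[OF assms(1)] by blast
  \<comment> \<open>The closure of the intersection lies in both flats, so meets are plain
    intersections.\<close>
  have "c (F1 \<inter> F2) = F1 \<inter> F2"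
    using closure_subset_flat[OF _ assms(1)] closure_subset_flat[OF _ assms(2)] extensive[OF sub]
    by blast
  then have "F1 \<inter> F2 \<in> c ` Pow E"
    using sub by (metis PowI imageI)
  with assms show ?thesis
    by (auto simp: greatest_def Lower_def)
qed

text \<open>The join is a Hilbert choice; antisymmetry of inclusion leaves only one least upper
  bound to choose.\<close>

lemma sup_flats:
  assumes "S \<subseteq> c ` Pow E"
  shows "\<Squnion>\<^bsub>flats\<^esub> S = c (\<Union>S)"
  unfolding Lattice.sup_def
proof (rule some_equality)
  show "least flats (c (\<Union>S)) (Upper flats S)"
    by (rule least_upper_flats[OF assms])
  fix F assume "least flats F (Upper flats S)"
  with least_upper_flats[OF assms] show "F = c (\<Union>S)"
    unfolding least_def by auto
qed

lemma bottom_flats: "\<bottom>\<^bsub>flats\<^esub> = c {}"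
proof -
  \<comment> \<open>This turns the bottom, chosen as a least element of the carrier, into the empty
    join.\<close>
  have "Upper flats {} = carrier flats"
    by (auto simp: Upper_def)
  then have "\<bottom>\<^bsub>flats\<^esub> = \<Squnion>\<^bsub>flats\<^esub> {}"
    by (simp add: bottom_def Lattice.sup_def)
  then show ?thesis
    by (simp add: sup_flats)
qed

text \<open>Closing \<open>X\<close> and \<open>Y\<close> separately first adds nothing beyond
  \<open>c (X \<union> Y)\<close>. This is what makes \<open>c\<close> itself preserve
  joins.\<close>

lemma join_flats:
  assumes "X \<subseteq> E" "Y \<subseteq> E"
  shows "c X \<squnion>\<^bsub>flats\<^esub> c Y = c (X \<union> Y)"
proof -
  have XY: "X \<union> Y \<subseteq> E"
    using assms by blast
  have "c X \<union> c Y \<subseteq> c (X \<union> Y)"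
    using monotone[of X "X \<union> Y"] monotone[of Y "X \<union> Y"] XY by blast
  then have "c (c X \<union> c Y) \<subseteq> c (X \<union> Y)"
    using XY by (intro closure_subset_flat) auto
  moreover have "c (X \<union> Y) \<subseteq> c (c X \<union> c Y)"
    using assms by (intro monotone) (use closed extensive in blast)+
  ultimately show ?thesis
    using assms by (simp add: join_def sup_flats)
qed

lemma lattice_flats: "Lattice.lattice flats"
proof unfold_locales
  fix F1 F2 assume F: "F1 \<in> carrier flats" "F2 \<in> carrier flats"
  then show "\<exists>s. least flats s (Upper flats {F1, F2})"
    using least_upper_flats[of "{F1, F2}"] by auto
  from F show "\<exists>s. greatest flats s (Lower flats {F1, F2})"
    using greatest_lower_flats[of F1 F2] by auto
qed auto

lemma generator_enriched_lattice_flats: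
  assumes "finite E"
  shows "generator_enriched_lattice flats flat_generators"
proof -
  have "\<exists>S \<subseteq> flat_generators. F = \<Squnion>\<^bsub>flats\<^esub> S" if F: "F \<in> c ` Pow E" for F
  proof (intro exI conjI)
    \<comment> \<open>A flat is the join of the closures of its points, and the bottom can be left
      out of a join.\<close>
    let ?S = "{c {e} | e. e \<in> F} - {c {}}"
    show "?S \<subseteq> flat_generators"
      using flat_subset[OF F] by (auto simp: flat_generators_def)
    have S: "?S \<subseteq> c ` Pow E"
      using flat_subset[OF F] by auto
    have US: "\<Union>?S \<subseteq> F"
      using closure_subset_flat[OF _ F] by blast
    then have USE: "\<Union>?S \<subseteq> E"
      using flat_subset[OF F] by blast
    have "e \<in> c (\<Union>?S)" if "e \<in> F" for e
    proof -
      have "e \<in> c {e}"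
        using extensive[of "{e}"] that flat_subset[OF F] by auto
      moreover have "c {} \<subseteq> c (\<Union>?S)"
        by (rule monotone) (use USE in auto)
      moreover have "\<Union>?S \<subseteq> c (\<Union>?S)"
        by (rule extensive[OF USE])
      ultimately show ?thesis
        \<comment> \<open>If \<open>c {e} = c {}\<close>, then \<open>e\<close> lies in
          \<open>c {}\<close> and so in every closure; otherwise \<open>c {e}\<close> belongs to
          \<open>?S\<close>.\<close>
        using that by (cases "c {e} = c {}") blast+
    qed
    then have "c (\<Union>?S) = F"
      using closure_subset_flat[OF US F] by blast
    then show "F = \<Squnion>\<^bsub>flats\<^esub> ?S"
      by (simp only: sup_flats[OF S])
  qed
  then show ?thesis
    using assms lattice_flats
    by (auto simp: generator_enriched_lattice_def bottom_flats flat_generators_def)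
qed

end

section \<open>The Boolean lattice\<close>

lemma closure_operator_id: "closure_operator E (\<lambda>X. X)"
  by unfold_locales auto

lemma carrier_boolean_lattice [simp]: "carrier (boolean_lattice E) = Pow E"
  by (simp add: boolean_lattice_def)

text \<open>All subsets are flats of the identity operator, so joins, bottom and generation in the
  Boolean lattice are instances of the results on flats.\<close>

lemma boolean_lattice_eq_flats: "boolean_lattice E = closure_operator.flats E (\<lambda>X. X)"
  by (simp add: boolean_lattice_def closure_operator.flats_def[OF closure_operator_id])

lemma generator_enriched_boolean_lattice:
  assumes "finite E"
  shows "generator_enriched_lattice (boolean_lattice E) (boolean_generators E)"
proof -
  interpret closure_operator E "\<lambda>X. X"
    by (rule closure_operator_id)
  have "boolean_generators E = flat_generators"
    by (auto simp: boolean_generators_def flat_generators_def)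
  then show ?thesis
    using generator_enriched_lattice_flats[OF assms] by (simp add: boolean_lattice_eq_flats)
qed

lemma join_boolean_lattice:
  "X \<subseteq> E \<Longrightarrow> Y \<subseteq> E \<Longrightarrow> X \<squnion>\<^bsub>boolean_lattice E\<^esub> Y = X \<union> Y"
  using closure_operator.join_flats[OF closure_operator_id] by (simp add: boolean_lattice_eq_flats)

lemma bottom_boolean_lattice: "\<bottom>\<^bsub>boolean_lattice E\<^esub> = {}"
  using closure_operator.bottom_flats[OF closure_operator_id] by (simp add: boolean_lattice_eq_flats)

section \<open>Realising a closure operator by a strong surjection and by a polymatroid\<close>

context closure_operator
begin

lemma strong_surjection_flats:
  assumes "finite E"
  shows "strong_surjection (boolean_lattice E) (boolean_generators E) flats flat_generators c"
proof -
  have "join_pres (boolean_lattice E) flats c"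
    using generator_enriched_boolean_lattice[OF assms] lattice_flats
    by (simp add: join_pres_def generator_enriched_lattice_def join_flats join_boolean_lattice)
  \<comment> \<open>Singletons with closure \<open>c {}\<close> go to the bottom; having
    \<open>c {}\<close> on both sides accounts for them.\<close>
  moreover have "c ` (boolean_generators E \<union> {{}}) = flat_generators \<union> {c {}}"
    by (auto simp: boolean_generators_def flat_generators_def)
  ultimately show ?thesis
    using assms generator_enriched_boolean_lattice generator_enriched_lattice_flats
    by (auto simp: strong_surjection_def strong_map_def bottom_flats bottom_boolean_lattice)
qed

text \<open>\<open>c X\<close> is the largest member of its own fiber: if \<open>c Y = c X\<close>
  then \<open>Y\<close> lies in \<open>c Y\<close>, and idempotence puts \<open>c X\<close> in the
  fiber.\<close>

lemma surjection_closure_self: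
  assumes "X \<subseteq> E"
  shows "surjection_closure E c X = c X"
proof -
  have "\<Union>{Y \<in> Pow E. c Y = c X} \<subseteq> c X"
    using extensive by blast
  moreover have "c X \<in> {Y \<in> Pow E. c Y = c X}"
    using assms closed idempotent by blast
  ultimately show ?thesis
    by (auto simp: surjection_closure_def fiber_union_def)
qed

definition flat_rank :: "'a set \<Rightarrow> real" where
  "flat_rank X = (\<Sum>F \<in> c ` Pow E. if X \<subseteq> F then 0 else 1)"

text \<open>Each summand satisfies the axioms: if \<open>F\<close> fails to contain
  \<open>X \<union> Y\<close> it fails to contain \<open>X\<close> or \<open>Y\<close>, and if it
  fails to contain \<open>X \<inter> Y\<close> it contains neither.\<close>

lemma polymatroid_flat_rank: "polymatroid E flat_rank"
  unfolding polymatroid_def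
proof (intro conjI ballI impI)
  fix X Y :: "'a set"
  show "flat_rank (X \<inter> Y) + flat_rank (X \<union> Y) \<le> flat_rank X + flat_rank Y"
    unfolding flat_rank_def sum.distrib [symmetric] by (rule sum_mono) auto
  show "flat_rank X \<le> flat_rank Y" if "X \<subseteq> Y"
    unfolding flat_rank_def by (rule sum_mono) (use that in auto)
qed (auto simp: flat_rank_def intro: sum_nonneg)

lemma polymatroid_closure_flat_rank:
  assumes "finite E" "X \<subseteq> E"
  shows "polymatroid_closure E flat_rank X = c X"
proof -
  have "flat_rank X = flat_rank (X \<union> {e}) \<longleftrightarrow> e \<in> c X" if "e \<in> E" for e
  proof
    assume "e \<in> c X"
    \<comment> \<open>A flat containing \<open>X\<close> contains \<open>c X\<close>, so adding
      \<open>e\<close> changes no summand.\<close>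
    then have "X \<union> {e} \<subseteq> F \<longleftrightarrow> X \<subseteq> F" if "F \<in> c ` Pow E" for F
      using closure_subset_flat[OF _ that] by blast
    then show "flat_rank X = flat_rank (X \<union> {e})"
      unfolding flat_rank_def by (intro sum.cong) auto
  next
    assume eq: "flat_rank X = flat_rank (X \<union> {e})"
    show "e \<in> c X"
    proof (rule ccontr)
      assume "e \<notin> c X"
      \<comment> \<open>The strict increase comes from the flat \<open>c X\<close>, which contains
        \<open>X\<close> but not \<open>e\<close>; the witness \<open>X\<close> names it.\<close>
      then have "flat_rank X < flat_rank (X \<union> {e})"
        unfolding flat_rank_def using assms extensive
        by (intro sum_strict_mono_ex1) (auto intro!: bexI[of _ X])
      with eq show False
        by simp
    qed
  qed
  then show ?thesis
    using closed[OF assms(2)] by (auto simp: polymatroid_closure_def)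
qed

end

section \<open>Polymatroid closures are closure operators\<close>

lemma polymatroid_rank_union_eq:
  assumes r: "polymatroid E r" and X: "X \<subseteq> E"
    and "finite Y" "Y \<subseteq> polymatroid_closure E r X"
  shows "r (X \<union> Y) = r X"
  using assms(3,4)
proof (induction Y rule: finite_induct)
  case (insert e Y)
  then have e: "e \<in> E" "r (X \<union> {e}) = r X" and Y: "Y \<subseteq> E"
    by (auto simp: polymatroid_closure_def)
  have sets: "X \<union> Y \<in> Pow E" "X \<union> {e} \<in> Pow E" "X \<union> insert e Y \<in> Pow E"
      "(X \<union> Y) \<inter> (X \<union> {e}) \<in> Pow E" "X \<in> Pow E"
    using X Y e by auto
  have "(X \<union> Y) \<union> (X \<union> {e}) = X \<union> insert e Y"
    by blast
  \<comment> \<open>The intersection contains \<open>X\<close>, so its rank is at least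
    \<open>r X\<close>; both terms on the right equal \<open>r X\<close>, which leaves at most
    \<open>r X\<close> for the enlarged union.\<close>
  then have "r ((X \<union> Y) \<inter> (X \<union> {e})) + r (X \<union> insert e Y) \<le> r (X \<union> Y) + r (X \<union> {e})"
    using r sets unfolding polymatroid_def by metis
  moreover have "r X \<le> r ((X \<union> Y) \<inter> (X \<union> {e}))"
    using r sets unfolding polymatroid_def by (metis Int_greatest Un_upper1)
  moreover have "r X \<le> r (X \<union> insert e Y)"
    using r sets unfolding polymatroid_def by (metis Un_upper1)
  ultimately show ?case
    using insert e by simp
qed simp

lemma closure_operator_polymatroid_closure:
  assumes "finite E" and r: "polymatroid E r"
  shows "closure_operator E (polymatroid_closure E r)"
proof
  let ?cl = "polymatroid_closure E r"
  fix X assume X: "X \<subseteq> E"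
  show cl_sub: "?cl X \<subseteq> E"
    by (auto simp: polymatroid_closure_def)
  show ext: "X \<subseteq> ?cl X"
    using X by (auto simp: polymatroid_closure_def insert_absorb)
  have fin: "finite (?cl X)"
    using cl_sub assms(1) by (rule finite_subset)
  \<comment> \<open>\<open>?cl X\<close> is finite, so all its elements can be adjoined to
    \<open>X\<close> together without raising the rank.\<close>
  have rank: "r (?cl X) = r X"
    using polymatroid_rank_union_eq[OF r X fin] ext by (simp add: Un_absorb1)
  have "e \<in> ?cl X" if "e \<in> ?cl (?cl X)" for e
  proof -
    have e: "e \<in> E" "r (?cl X \<union> {e}) = r X"
      using that rank by (auto simp: polymatroid_closure_def)
    have "X \<union> {e} \<in> Pow E" "?cl X \<union> {e} \<in> Pow E" "X \<in> Pow E"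
      using X e cl_sub by auto
    moreover have "X \<subseteq> X \<union> {e}" "X \<union> {e} \<subseteq> ?cl X \<union> {e}"
      using ext by auto
    \<comment> \<open>This squeezes \<open>r (X \<union> {e})\<close>, since
      \<open>r (?cl X \<union> {e})\<close> equals \<open>r X\<close>.\<close>
    ultimately have "r X \<le> r (X \<union> {e})" "r (X \<union> {e}) \<le> r (?cl X \<union> {e})"
      using r unfolding polymatroid_def by blast+
    with e show ?thesis
      by (simp add: polymatroid_closure_def)
  qed
  moreover have "?cl X \<subseteq> ?cl (?cl X)"
    using cl_sub by (auto simp: polymatroid_closure_def insert_absorb)
  ultimately show "?cl (?cl X) = ?cl X"
    by blast
next
  let ?cl = "polymatroid_closure E r"
  fix X Y assume XY: "X \<subseteq> Y" and Y: "Y \<subseteq> E"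
  show "?cl X \<subseteq> ?cl Y"
  proof
    fix e assume "e \<in> ?cl X"
    then have e: "e \<in> E" "r (X \<union> {e}) = r X"
      by (auto simp: polymatroid_closure_def)
    show "e \<in> ?cl Y"
    proof (cases "e \<in> Y")
      case True
      then show ?thesis
        using e by (simp add: polymatroid_closure_def insert_absorb)
    next
      case False
      have sets: "Y \<in> Pow E" "X \<union> {e} \<in> Pow E" "Y \<union> {e} \<in> Pow E"
        using XY Y e by auto
      \<comment> \<open>Submodularity as diminishing returns: an element that adds nothing to
        \<open>X\<close> adds nothing to the larger \<open>Y\<close>. As \<open>e\<close> is outside
        \<open>Y\<close>, the intersection is exactly \<open>X\<close>.\<close>
      have "Y \<inter> (X \<union> {e}) = X" "Y \<union> (X \<union> {e}) = Y \<union> {e}"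
        using XY False by auto
      then have "r X + r (Y \<union> {e}) \<le> r Y + r (X \<union> {e})"
        using r sets unfolding polymatroid_def by metis
      moreover have "r Y \<le> r (Y \<union> {e})"
        using r sets unfolding polymatroid_def by (metis Un_upper1)
      ultimately show ?thesis
        using e by (simp add: polymatroid_closure_def)
    qed
  qed
qed

section \<open>Closures of strong surjections are closure operators\<close>

lemma strong_surjection_union:
  assumes "strong_surjection (boolean_lattice E) (boolean_generators E) L G \<theta>"
    and "X \<subseteq> E" "Y \<subseteq> E"
  shows "\<theta> (X \<union> Y) = \<theta> X \<squnion>\<^bsub>L\<^esub> \<theta> Y"
proof -
  have "\<theta> (X \<squnion>\<^bsub>boolean_lattice E\<^esub> Y) = \<theta> X \<squnion>\<^bsub>L\<^esub> \<theta> Y"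
    using assms
    by (simp add: strong_surjection_def strong_map_def join_pres_def)
  then show ?thesis
    using assms by (simp add: join_boolean_lattice)
qed

text \<open>A finite fibre of \<open>\<theta>\<close> is closed under binary unions, hence contains its own union.\<close>

lemma strong_surjection_closure_in_fiber:
  assumes "finite E"
    and \<theta>: "strong_surjection (boolean_lattice E) (boolean_generators E) L G \<theta>"
    and X: "X \<subseteq> E"
  shows "\<theta> (surjection_closure E \<theta> X) = \<theta> X"
proof -
  have idem: "\<theta> X \<squnion>\<^bsub>L\<^esub> \<theta> X = \<theta> X"
    using strong_surjection_union[OF \<theta> X X] by simp
  \<comment> \<open>\<open>A\<close> is nonempty because the empty union could lie outside the
    fiber.\<close>
  have "\<theta> (\<Union>A) = \<theta> X \<and> \<Union>A \<subseteq> E"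
    if "finite A" "A \<noteq> {}" "A \<subseteq> {Y \<in> Pow E. \<theta> Y = \<theta> X}" for A
    using that
  proof (induction A rule: finite_ne_induct)
    case (insert Y A)
    then have "Y \<subseteq> E" "\<Union>A \<subseteq> E" "\<theta> Y = \<theta> X" "\<theta> (\<Union>A) = \<theta> X"
      by auto
    then show ?case
      using strong_surjection_union[OF \<theta>, of Y "\<Union>A"] idem by auto
  qed auto
  moreover have "finite {Y \<in> Pow E. \<theta> Y = \<theta> X}" "X \<in> {Y \<in> Pow E. \<theta> Y = \<theta> X}"
    using assms(1) X by auto
  ultimately show ?thesis
    unfolding surjection_closure_def fiber_union_def comp_def by blast
qed

lemma closure_operator_surjection_closure:
  assumes fin: "finite E"
    and \<theta>: "strong_surjection (boolean_lattice E) (boolean_generators E) L G \<theta>"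
  shows "closure_operator E (surjection_closure E \<theta>)"
proof
  let ?cl = "surjection_closure E \<theta>"
  fix X assume X: "X \<subseteq> E"
  show "?cl X \<subseteq> E" "X \<subseteq> ?cl X"
    using X by (auto simp: surjection_closure_def fiber_union_def)
  show "?cl (?cl X) = ?cl X"
    \<comment> \<open>\<open>?cl\<close> depends on its argument only through the image under
      \<open>\<theta>\<close>, which \<open>?cl X\<close> shares with \<open>X\<close>.\<close>
    using strong_surjection_closure_in_fiber[OF fin \<theta> X] by (simp add: surjection_closure_def)
next
  let ?cl = "surjection_closure E \<theta>"
  fix X Y assume XY: "X \<subseteq> Y" and Y: "Y \<subseteq> E"
  then have X: "X \<subseteq> E"
    by blast
  have clX: "?cl X \<subseteq> E"
    by (auto simp: surjection_closure_def fiber_union_def)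
  \<comment> \<open>Adjoining \<open>?cl X\<close> to \<open>Y\<close> has the same effect under
    \<open>\<theta>\<close> as adjoining \<open>X\<close>, namely none, so the union stays in the
    fiber of \<open>Y\<close>.\<close>
  have "\<theta> (?cl X \<union> Y) = \<theta> X \<squnion>\<^bsub>L\<^esub> \<theta> Y"
    using strong_surjection_union[OF \<theta> clX Y] strong_surjection_closure_in_fiber[OF fin \<theta> X]
    by simp
  also have "\<dots> = \<theta> Y"
    using strong_surjection_union[OF \<theta> X Y] XY by (simp add: Un_absorb1)
  finally have "?cl X \<union> Y \<in> {Z \<in> Pow E. \<theta> Z = \<theta> Y}"
    using clX Y by simp
  then show "?cl X \<subseteq> ?cl Y"
    unfolding surjection_closure_def[of E \<theta>] fiber_union_def comp_def by blast
qed

text \<open>The theorem compares operators on \<open>Pow E\<close> only; the axioms evaluate them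
  nowhere else, as \<open>d\<close> maps \<open>Pow E\<close> into itself.\<close>

lemma closure_operator_cong:
  assumes "closure_operator E d" and eq: "\<forall>X \<in> Pow E. c X = d X"
  shows "closure_operator E c"
proof -
  interpret d: closure_operator E d
    by fact
  show ?thesis
  proof
    fix X Y assume "X \<subseteq> Y" "Y \<subseteq> E"
    then show "c X \<subseteq> c Y"
      using d.monotone[of X Y] eq by auto
  qed (simp_all add: eq d.closed d.extensive d.idempotent)
qed

section \<open>Equivalence of the two kinds of closure operators\<close>

lemma polymatroid_closure_iff_closure_operator:
  assumes "finite E"
  shows "(\<exists>r. polymatroid E r \<and> (\<forall>X \<in> Pow E. c X = polymatroid_closure E r X)) \<longleftrightarrow>
    closure_operator E c"
proof
  assume "closure_operator E c"
  then interpret closure_operator E c .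
  show "\<exists>r. polymatroid E r \<and> (\<forall>X \<in> Pow E. c X = polymatroid_closure E r X)"
    using polymatroid_flat_rank polymatroid_closure_flat_rank[OF assms]
    by (intro exI[of _ flat_rank]) auto
qed (metis closure_operator_cong closure_operator_polymatroid_closure[OF assms])

theorem mainTheorem4:
  fixes E :: "'a set" and c :: "'a set \<Rightarrow> 'a set"
  assumes "finite E" and "c \<in> Pow E \<rightarrow> Pow E"
  shows
    "((\<exists>r. polymatroid E r \<and> (\<forall>X \<in> Pow E. c X = polymatroid_closure E r X)) \<longleftrightarrow>
      (\<exists>(L :: 'a set gorder) G \<theta>.
         strong_surjection (boolean_lattice E) (boolean_generators E) L G \<theta> \<and>
         (\<forall>X \<in> Pow E. c X = surjection_closure E \<theta> X))) \<and>
     (\<forall>(L :: 'l gorder) G \<theta>.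
         strong_surjection (boolean_lattice E) (boolean_generators E) L G \<theta> \<and>
         (\<forall>X \<in> Pow E. c X = surjection_closure E \<theta> X) \<longrightarrow>
         (\<exists>r. polymatroid E r \<and> (\<forall>X \<in> Pow E. c X = polymatroid_closure E r X)))"
  unfolding polymatroid_closure_iff_closure_operator[OF assms(1)]
proof (intro conjI iffI allI impI)
  assume "closure_operator E c"
  then interpret closure_operator E c .
  \<comment> \<open>The lattice of flats consists of subsets of \<open>E\<close>, which explains the
    element type \<open>'a set\<close>.\<close>
  show "\<exists>(L :: 'a set gorder) G \<theta>.
      strong_surjection (boolean_lattice E) (boolean_generators E) L G \<theta> \<and>
      (\<forall>X \<in> Pow E. c X = surjection_closure E \<theta> X)"
    using strong_surjection_flats[OF assms(1)] surjection_closure_self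
    by (intro exI[of _ flats] exI[of _ flat_generators] exI[of _ c]) auto
\<comment> \<open>Both remaining claims start from a strong surjection; the lemma on its closure
  holds for any element type of \<open>L\<close>, so it serves \<open>'a set\<close> and
  \<open>'l\<close> alike.\<close>
qed (metis closure_operator_cong closure_operator_surjection_closure[OF assms(1)])+

end
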